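(* Let $A=M_1+M_2\mathbf{j}\in\mathbb{Q}_{\mathbb{R}}^{m\times n}$, $B=N_1+N_2\mathbf{j}\in\mathbb{Q}_{\mathbb{R}}^{m\times d}$, $C=R_1+R_2\mathbf{j}\in\mathbb{Q}_{\mathbb{R}}^{p\times n}$, $D=S_1+S_2\mathbf{j}\in\mathbb{Q}_{\mathbb{R}}^{p\times d}$, where $M_l,N_l,R_l,S_l$ ($l=1,2$) are complex matrices. Assume $m\ge n+d$ and that $C^C_c\in\mathbb{C}^{2p\times n}$ has full row rank. Consider the reduced biquaternion equality constrained least squares (RBLSE) problem over complex matrices $$\min_{X\in\mathbb{C}^{n\times d}}\|AX-B\|_F\quad\text{subject to}\quad CX=D \qquad(\mathrm{I})$$ and the complex equality constrained least squares (LSE) problem $$\min_{X\in\mathbb{C}^{n\times d}}\|A^C_cX-B^C_c\|_F\quad\text{subject to}\quad C^C_cX=D^C_c. \qquad(\mathrm{II})$$ Let the QR factorization of $(C^C_c)^H$ be $$(C^C_c)^H=\widetilde Q\begin{bmatrix}\widetilde R\\0\end{bmatrix},$$ where $\widetilde Q\in\mathbb{C}^{n\times n}$ is unitary and $\widetilde R\in\mathbb{C}^{2p\times 2p}$ is nonsingular upper triangular, and partition $$A^C_c\widetilde Q=[\widetilde P_1,\widetilde P_2],\qquad \widetilde P_1\in\mathbb{C}^{2m\times 2p},\quad \widetilde P_2\in\mathbb{C}^{2m\times(n-2p)}.$$ Let $X\in\mathbb{C}^{n\times d}$. Then $X$ is a (complex) solution of the RBLSE problem (I) if and only if $X$ solves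 the complex LSE problem (II). In this scenario, the unique solution $X$ with minimum norm is $$X=\widetilde Q\begin{bmatrix}(\widetilde R^H)^{-1}D^C_c\\ \widetilde P_2^{\dagger}\bigl(B^C_c-\widetilde P_1(\widetilde R^H)^{-1}D^C_c\bigr)\end{bmatrix}.$$
   Context: Reduced biquaternions: $\mathbb{Q}_{\mathbb{R}}$ is the set of elements $\zeta=p_0+p_1\mathbf{i}+p_2\mathbf{j}+p_3\mathbf{k}$ with $p_l\in\mathbb{R}$, with commutative multiplication given by $\mathbf{i}^2=\mathbf{k}^2=-1$, $\mathbf{j}^2=1$, $\mathbf{i}\mathbf{j}=\mathbf{j}\mathbf{i}=\mathbf{k}$, $\mathbf{j}\mathbf{k}=\mathbf{k}\mathbf{j}=\mathbf{i}$, $\mathbf{k}\mathbf{i}=\mathbf{i}\mathbf{k}=-\mathbf{j}$. Equivalently $\zeta=r_1+r_2\mathbf{j}$ with $r_1=p_0+p_1\mathbf{i}$, $r_2=p_2+p_3\mathbf{i}\in\mathbb{C}$ (the complex imaginary unit is identified with $\mathbf{i}$). The norm is $\|\zeta\|=\sqrt{p_0^2+p_1^2+p_2^2+p_3^2}=\sqrt{|r_1|^2+|r_2|^2}$. $\mathbb{Q}_{\mathbb{R}}^{m\times n}$ is the set of $m\times n$ matrices over $\mathbb{Q}_{\mathbb{R}}$; complex matrices are regarded as elements of it. For $M=(m_{st})\in\mathbb{Q}_{\mathbb{R}}^{m\times n}$ the Frobenius norm is $\|M\|_F=\sqrt{\sum_{s,t}\|m_{st}\|^2}$; for complex matrices $\|\cdot\|_F$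 is the usual Frobenius norm. For $M=L_1+L_2\mathbf{j}\in\mathbb{Q}_{\mathbb{R}}^{m\times n}$ with $L_1,L_2\in\mathbb{C}^{m\times n}$, define $M^C_c=[L_1^T,L_2^T]^T\in\mathbb{C}^{2m\times n}$ (the first block column of the complex representation of $M$). $[P,Q]$ denotes horizontal concatenation, $P^H$ the conjugate transpose and $P^{\dagger}$ the Moore–Penrose inverse. "Minimum norm" refers to the Frobenius norm among all solutions. *)

theory Defs
  imports
    Complex_Main
    "Jordan_Normal_Form.Matrix"
    "Jordan_Normal_Form.DL_Rank"
    "Jordan_Normal_Form.Schur_Decomposition"
    "Jordan_Normal_Form.Gauss_Jordan_Elimination"
begin

datatype rbq = RBQ (rbq_re: real) (rbq_im_i: real) (rbq_im_j: real) (rbq_im_k: real)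

instantiation rbq :: comm_ring_1
begin

definition "0 = RBQ 0 0 0 0"
definition "1 = RBQ 1 0 0 0"
definition "- x = RBQ (- rbq_re x) (- rbq_im_i x) (- rbq_im_j x) (- rbq_im_k x)"
definition "x + y = RBQ (rbq_re x + rbq_re y) (rbq_im_i x + rbq_im_i y)
                        (rbq_im_j x + rbq_im_j y) (rbq_im_k x + rbq_im_k y)"
definition "x - y = RBQ (rbq_re x - rbq_re y) (rbq_im_i x - rbq_im_i y)
                        (rbq_im_j x - rbq_im_j y) (rbq_im_k x - rbq_im_k y)"

text \<open>Bilinear extension of the multiplication table proved in \<open>rbq_table\<close> below.\<close>

definition "x * y = RBQ
  (rbq_re x * rbq_re y - rbq_im_i x * rbq_im_i y + rbq_im_j x * rbq_im_j y - rbq_im_k x * rbq_im_k y)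
  (rbq_re x * rbq_im_i y + rbq_im_i x * rbq_re y + rbq_im_j x * rbq_im_k y + rbq_im_k x * rbq_im_j y)
  (rbq_re x * rbq_im_j y + rbq_im_j x * rbq_re y - rbq_im_i x * rbq_im_k y - rbq_im_k x * rbq_im_i y)
  (rbq_re x * rbq_im_k y + rbq_im_k x * rbq_re y + rbq_im_i x * rbq_im_j y + rbq_im_j x * rbq_im_i y)"

instance
  by standard
    (simp_all add: zero_rbq_def one_rbq_def uminus_rbq_def plus_rbq_def minus_rbq_def
      times_rbq_def algebra_simps)

end

definition rbq_i :: rbq where "rbq_i = RBQ 0 1 0 0"
definition rbq_j :: rbq where "rbq_j = RBQ 0 0 1 0"
definition rbq_k :: rbq where "rbq_k = RBQ 0 0 0 1"

lemma rbq_table: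
  "rbq_i * rbq_i = - 1" "rbq_j * rbq_j = 1" "rbq_k * rbq_k = - 1"
  "rbq_i * rbq_j = rbq_k" "rbq_j * rbq_i = rbq_k"
  "rbq_j * rbq_k = rbq_i" "rbq_k * rbq_j = rbq_i"
  "rbq_k * rbq_i = - rbq_j" "rbq_i * rbq_k = - rbq_j"
  by (simp_all add: rbq_i_def rbq_j_def rbq_k_def one_rbq_def uminus_rbq_def times_rbq_def)

definition rbq_of_complex :: "complex \<Rightarrow> rbq" where
  "rbq_of_complex z = RBQ (Re z) (Im z) 0 0"

text \<open>The complex numbers \<open>r1\<close>, \<open>r2\<close> with \<open>x = r1 + r2 j\<close>.\<close>

definition rbq_c1 :: "rbq \<Rightarrow> complex" where
  "rbq_c1 x = Complex (rbq_re x) (rbq_im_i x)"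

definition rbq_c2 :: "rbq \<Rightarrow> complex" where
  "rbq_c2 x = Complex (rbq_im_j x) (rbq_im_k x)"

lemma rbq_decomp: "x = rbq_of_complex (rbq_c1 x) + rbq_of_complex (rbq_c2 x) * rbq_j"
  by (simp add: rbq_of_complex_def rbq_c1_def rbq_c2_def rbq_j_def plus_rbq_def times_rbq_def)

instantiation rbq :: real_vector
begin

definition "c *\<^sub>R x = RBQ (c * rbq_re x) (c * rbq_im_i x) (c * rbq_im_j x) (c * rbq_im_k x)"

instance
  by standard (simp_all add: scaleR_rbq_def plus_rbq_def algebra_simps)

end

instantiation rbq :: real_normed_vector
begin

definition "norm x = sqrt ((rbq_re x)\<^sup>2 + (rbq_im_i x)\<^sup>2 + (rbq_im_j x)\<^sup>2 + (rbq_im_k x)\<^sup>2)"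
definition "sgn x = x /\<^sub>R norm x" for x :: rbq
definition "dist x y = norm (x - y)" for x y :: rbq
definition "uniformity = (INF e\<in>{0<..}. principal {(x :: rbq, y). dist x y < e})"
definition "open U \<longleftrightarrow> (\<forall>x\<in>U. \<forall>\<^sub>F (x', y) in uniformity. x' = x \<longrightarrow> y \<in> U)" for U :: "rbq set"

lemma norm_rbq_complex: "norm x = sqrt ((cmod (rbq_c1 x))\<^sup>2 + (cmod (rbq_c2 x))\<^sup>2)"
  by (simp add: norm_rbq_def rbq_c1_def rbq_c2_def cmod_power2 add.assoc)

instance
proof
  fix x y z :: rbq and a :: real
  show "dist x y = norm (x - y)" "sgn x = x /\<^sub>R norm x"
    by (rule dist_rbq_def sgn_rbq_def)+
  show "uniformity = (INF e\<in>{0<..}. principal {(x :: rbq, y). dist x y < e})"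
    by (rule uniformity_rbq_def)
  show "open U \<longleftrightarrow> (\<forall>x\<in>U. \<forall>\<^sub>F (x', y) in uniformity. x' = x \<longrightarrow> y \<in> U)" for U :: "rbq set"
    by (rule open_rbq_def)
  show "norm x = 0 \<longleftrightarrow> x = 0"
    by (cases x) (auto simp: norm_rbq_complex rbq_c1_def rbq_c2_def zero_rbq_def
        complex_eq_iff sum_power2_eq_zero_iff)
  have "norm (x + y) =
      sqrt ((cmod (rbq_c1 x + rbq_c1 y))\<^sup>2 + (cmod (rbq_c2 x + rbq_c2 y))\<^sup>2)"
    by (simp add: norm_rbq_complex rbq_c1_def rbq_c2_def plus_rbq_def complex_add)
  also have "\<dots> \<le> sqrt ((cmod (rbq_c1 x) + cmod (rbq_c1 y))\<^sup>2 + (cmod (rbq_c2 x) + cmod (rbq_c2 y))\<^sup>2)"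
    by (intro real_sqrt_le_mono add_mono power_mono norm_triangle_ineq norm_ge_zero)
  also have "\<dots> \<le> norm x + norm y"
    unfolding norm_rbq_complex by (rule real_sqrt_sum_squares_triangle_ineq)
  finally show "norm (x + y) \<le> norm x + norm y" .
  have "norm (a *\<^sub>R x) = sqrt (a\<^sup>2 * ((rbq_re x)\<^sup>2 + (rbq_im_i x)\<^sup>2 + (rbq_im_j x)\<^sup>2 + (rbq_im_k x)\<^sup>2))"
    by (simp add: norm_rbq_def scaleR_rbq_def algebra_simps)
  then show "norm (a *\<^sub>R x) = \<bar>a\<bar> * norm x"
    by (simp add: norm_rbq_def real_sqrt_mult)
qed

end

abbreviation rbq_mat :: "complex mat \<Rightarrow> rbq mat" where
  "rbq_mat X \<equiv> map_mat rbq_of_complex X"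

text \<open>The matrix \<open>L1 + L2 j\<close>; multiplication is commutative, so the scalar \<open>j\<close> may stand on the left.\<close>

definition rbq_mat2 :: "complex mat \<Rightarrow> complex mat \<Rightarrow> rbq mat" where
  "rbq_mat2 L1 L2 = rbq_mat L1 + rbq_j \<cdot>\<^sub>m rbq_mat L2"

text \<open>First block column of the complex representation of a reduced biquaternion matrix.\<close>

definition block_col :: "rbq mat \<Rightarrow> complex mat" where
  "block_col M = map_mat rbq_c1 M @\<^sub>r map_mat rbq_c2 M"

lemma block_col_rbq_mat2:
  assumes "L1 \<in> carrier_mat r c" "L2 \<in> carrier_mat r c"
  shows "block_col (rbq_mat2 L1 L2) = L1 @\<^sub>r L2"
proof -
  have "map_mat rbq_c1 (rbq_mat2 L1 L2) = L1" "map_mat rbq_c2 (rbq_mat2 L1 L2) = L2"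
    using assms
    by (auto intro!: eq_matI simp: rbq_mat2_def rbq_c1_def rbq_c2_def rbq_of_complex_def rbq_j_def
        plus_rbq_def times_rbq_def)
  then show ?thesis by (simp add: block_col_def)
qed

definition append_cols :: "'a :: zero mat \<Rightarrow> 'a mat \<Rightarrow> 'a mat" (infixr \<open>@\<^sub>c\<close> 65) where
  "A @\<^sub>c B = four_block_mat A B (0\<^sub>m 0 (dim_col A)) (0\<^sub>m 0 (dim_col B))"

definition frob_norm :: "'a :: real_normed_vector mat \<Rightarrow> real" where
  "frob_norm M = sqrt (\<Sum>s<dim_row M. \<Sum>t<dim_col M. (norm (M $$ (s, t)))\<^sup>2)"

definition unitary_mat :: "complex mat \<Rightarrow> bool" where
  "unitary_mat U \<longleftrightarrow>
    square_mat U \<and> inverts_mat U (mat_adjoint U) \<and> inverts_mat (mat_adjoint U) U"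

text \<open>The Moore-Penrose inverse, characterised by the four Penrose equations.\<close>

definition is_pinv :: "complex mat \<Rightarrow> complex mat \<Rightarrow> bool" where
  "is_pinv P G \<longleftrightarrow> G \<in> carrier_mat (dim_col P) (dim_row P) \<and>
     P * G * P = P \<and> G * P * G = G \<and>
     mat_adjoint (P * G) = P * G \<and> mat_adjoint (G * P) = G * P"

definition pinv :: "complex mat \<Rightarrow> complex mat" where
  "pinv P = (THE G. is_pinv P G)"

text \<open>\<open>mat_inverse\<close> returns an option; the value here is meaningful for invertible matrices only.\<close>

abbreviation inv_mat :: "complex mat \<Rightarrow> complex mat" where
  "inv_mat M \<equiv> the (mat_inverse M)"

definition rblse_solution ::
    "nat \<Rightarrow> nat \<Rightarrow> rbq mat \<Rightarrow> rbq mat \<Rightarrow> rbq mat \<Rightarrow> rbq mat \<Rightarrow> complex mat \<Rightarrow> bool" where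
  "rblse_solution n d A B C D = is_arg_min
     (\<lambda>X. frob_norm (A * rbq_mat X - B))
     (\<lambda>X. X \<in> carrier_mat n d \<and> C * rbq_mat X = D)"

definition lse_solution ::
    "nat \<Rightarrow> nat \<Rightarrow> complex mat \<Rightarrow> complex mat \<Rightarrow> complex mat \<Rightarrow> complex mat \<Rightarrow> complex mat \<Rightarrow> bool" where
  "lse_solution n d A B C D = is_arg_min
     (\<lambda>X. frob_norm (A * X - B))
     (\<lambda>X. X \<in> carrier_mat n d \<and> C * X = D)"

end

theory Submission
  imports Defs
begin

text \<open>The block column is a real-linear isometry that commutes with right multiplication by complex
  matrices, so both problems have the same constraint set and the same objective. In the unitary
  coordinates \<open>X = Q [T; Y]\<close> the constraint says \<open>R\<^sup>H T = D\<close> (block columns understood), which determines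
  \<open>T\<close>; the objective becomes \<open>\<parallel>P2 Y - W\<parallel>\<close> with \<open>W = B - P1 T\<close>, and \<open>\<parallel>X\<parallel>\<^sup>2 = \<parallel>T\<parallel>\<^sup>2 + \<parallel>Y\<parallel>\<^sup>2\<close>.
  Two orthogonality relations from the Penrose equations finish the proof: the residual at
  \<open>P2\<^sup>\<dagger> W\<close> is orthogonal to the range of \<open>P2\<close>, and \<open>P2\<^sup>\<dagger> W\<close> is orthogonal to its kernel.\<close>

section \<open>Matrix algebra with dimension side conditions\<close>

text \<open>The library versions ask for carriers with intermediate dimensions, which the simplifier
  cannot guess for compound factors; equations between dimensions it can discharge.\<close>

lemma mat_assoc_dim:
  fixes A :: "'a :: semiring_0 mat"
  assumes "dim_col A = dim_row B" "dim_col B = dim_row C"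
  shows "A * B * C = A * (B * C)"
  by (rule assoc_mult_mat[of A "dim_row A" "dim_col A" B "dim_col B" C "dim_col C"]) (use assms in auto)

lemma mat_distrib_dim:
  fixes A :: "'a :: ring mat"
  assumes "dim_row B = dim_row C" "dim_col B = dim_col C"
  shows "dim_col A = dim_row C \<Longrightarrow> A * (B + C) = A * B + A * C"
    and "dim_col A = dim_row C \<Longrightarrow> A * (B - C) = A * B - A * C"
    and "dim_col C = dim_row A \<Longrightarrow> (B + C) * A = B * A + C * A"
    and "dim_col C = dim_row A \<Longrightarrow> (B - C) * A = B * A - C * A"
proof -
  show "A * (B + C) = A * B + A * C" if "dim_col A = dim_row C"
    by (rule mult_add_distrib_mat[of _ "dim_row A" "dim_col A" _ "dim_col B"]) (use assms that in auto)
  show "A * (B - C) = A * B - A * C" if "dim_col A = dim_row C"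
    by (rule mult_minus_distrib_mat[of _ "dim_row A" "dim_col A" _ "dim_col B"]) (use assms that in auto)
  show "(B + C) * A = B * A + C * A" if "dim_col C = dim_row A"
    by (rule add_mult_distrib_mat[of _ "dim_row B" "dim_col B" _ _ "dim_col A"]) (use assms that in auto)
  show "(B - C) * A = B * A - C * A" if "dim_col C = dim_row A"
    by (rule minus_mult_distrib_mat[of _ "dim_row B" "dim_col B" _ _ "dim_col A"]) (use assms that in auto)
qed

lemma mat_one_mult_dim:
  fixes A :: "'a :: semiring_1 mat"
  shows "dim_row A = k \<Longrightarrow> 1\<^sub>m k * A = A" "dim_col A = k \<Longrightarrow> A * 1\<^sub>m k = A"
  by (auto intro: left_mult_one_mat right_mult_one_mat)

lemma mat_zero_mult_dim:
  fixes A :: "'a :: semiring_0 mat"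
  shows "dim_row A = k \<Longrightarrow> 0\<^sub>m r k * A = 0\<^sub>m r (dim_col A)"
    "dim_col A = k \<Longrightarrow> A * 0\<^sub>m k c = 0\<^sub>m (dim_row A) c"
  by (auto intro: left_mult_zero_mat right_mult_zero_mat)

lemma mat_eq_iff_minus_zero:
  fixes A :: "'a :: group_add mat"
  assumes "A \<in> carrier_mat r c" "B \<in> carrier_mat r c"
  shows "A = B \<longleftrightarrow> A - B = 0\<^sub>m r c"
proof
  assume *: "A - B = 0\<^sub>m r c"
  have "A $$ (i, j) = B $$ (i, j)" if "i < r" "j < c" for i j
    using arg_cong[OF *, of "\<lambda>M. M $$ (i, j)"] assms that by simp
  then show "A = B"
    using assms by (intro eq_matI) auto
qed (use assms in auto)

section \<open>Conjugate transposes\<close>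

lemma dim_mat_adjoint [simp]:
  "dim_row (mat_adjoint A) = dim_col A" "dim_col (mat_adjoint A) = dim_row A"
  by (auto simp: mat_adjoint_def)

lemma index_mat_adjoint [simp]:
  fixes A :: "complex mat"
  assumes "i < dim_col A" "j < dim_row A"
  shows "mat_adjoint A $$ (i, j) = cnj (A $$ (j, i))"
  using assms by (simp add: mat_adjoint_def mat_of_rows_index)

lemma mat_adjoint_carrier:
  "A \<in> carrier_mat r c \<Longrightarrow> mat_adjoint A \<in> carrier_mat c r"
  by (intro carrier_matI) auto

lemma mat_adjoint_adjoint [simp]:
  fixes A :: "complex mat"
  shows "mat_adjoint (mat_adjoint A) = A"
  by (intro eq_matI) auto

lemma mat_adjoint_mult:
  fixes A B :: "complex mat"
  assumes "dim_col A = dim_row B"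
  shows "mat_adjoint (A * B) = mat_adjoint B * mat_adjoint A"
  using assms by (intro eq_matI) (auto simp: scalar_prod_def mult.commute)

lemma mat_adjoint_minus:
  fixes A B :: "complex mat"
  assumes "dim_row A = dim_row B" "dim_col A = dim_col B"
  shows "mat_adjoint (A - B) = mat_adjoint A - mat_adjoint B"
  using assms by (intro eq_matI) auto

lemma mat_adjoint_add:
  fixes A B :: "complex mat"
  assumes "dim_row A = dim_row B" "dim_col A = dim_col B"
  shows "mat_adjoint (A + B) = mat_adjoint A + mat_adjoint B"
  using assms by (intro eq_matI) auto

lemma mat_adjoint_one [simp]: "mat_adjoint (1\<^sub>m k :: complex mat) = 1\<^sub>m k"
  by (intro eq_matI) auto

lemma mat_adjoint_zero [simp]: "mat_adjoint (0\<^sub>m r c :: complex mat) = 0\<^sub>m c r"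
  by (intro eq_matI) auto

text \<open>Expands a matrix expression into sums and differences of right-nested products with
  adjoints pushed onto the factors. The side conditions are equations between dimensions, so later
  proofs first collect the dimensions of all factors under \<open>dims\<close>.\<close>

lemmas mat_dim_simps =
  mat_assoc_dim mat_distrib_dim mat_one_mult_dim mat_zero_mult_dim
  mat_adjoint_mult mat_adjoint_minus mat_adjoint_add

section \<open>Horizontal and vertical concatenation\<close>

lemma append_cols_mult_append_rows:
  fixes A1 A2 Y1 Y2 :: "'a :: comm_ring_1 mat"
  assumes "A1 \<in> carrier_mat r a" "A2 \<in> carrier_mat r b"
    and "Y1 \<in> carrier_mat a c" "Y2 \<in> carrier_mat b c"
  shows "(A1 @\<^sub>c A2) * (Y1 @\<^sub>r Y2) = A1 * Y1 + A2 * Y2"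
proof -
  \<comment> \<open>Both concatenations are four-block matrices with empty blocks: zero rows below
    the left factor, zero columns to the right of the right factor. Block multiplication therefore
    applies.\<close>
  have "(A1 @\<^sub>c A2) * (Y1 @\<^sub>r Y2) =
      four_block_mat A1 A2 (0\<^sub>m 0 a) (0\<^sub>m 0 b) * four_block_mat Y1 (0\<^sub>m a 0) Y2 (0\<^sub>m b 0)"
    using assms by (auto simp: append_cols_def append_rows_def)
  also have "\<dots> = four_block_mat (A1 * Y1 + A2 * Y2) (A1 * 0\<^sub>m a 0 + A2 * 0\<^sub>m b 0)
      (0\<^sub>m 0 a * Y1 + 0\<^sub>m 0 b * Y2) (0\<^sub>m 0 a * 0\<^sub>m a 0 + 0\<^sub>m 0 b * 0\<^sub>m b 0)"
    by (rule mult_four_block_mat) (use assms in auto)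
  also have "\<dots> = A1 * Y1 + A2 * Y2"
    using assms by (intro eq_matI) auto
  finally show ?thesis .
qed

lemma mat_adjoint_append_rows:
  fixes A B :: "complex mat"
  assumes "A \<in> carrier_mat a c" "B \<in> carrier_mat b c"
  shows "mat_adjoint (A @\<^sub>r B) = mat_adjoint A @\<^sub>c mat_adjoint B"
  using assms by (intro eq_matI) (auto simp: append_rows_def append_cols_def)

lemma append_rows_mult:
  fixes A B X :: "'a :: comm_ring_1 mat"
  assumes "A \<in> carrier_mat a k" "B \<in> carrier_mat b k" "X \<in> carrier_mat k c"
  shows "(A @\<^sub>r B) * X = A * X @\<^sub>r B * X"
  using assms by (intro eq_matI) (auto simp: append_rows_def scalar_prod_def)

lemma append_rows_inject:
  assumes "A \<in> carrier_mat a c" "A' \<in> carrier_mat a c" "B \<in> carrier_mat b c" "B' \<in> carrier_mat b c"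
  shows "A @\<^sub>r B = A' @\<^sub>r B' \<longleftrightarrow> A = A' \<and> B = B'"
proof
  assume eq: "A @\<^sub>r B = A' @\<^sub>r B'"
  have "A $$ (i, j) = A' $$ (i, j)" if "i < a" "j < c" for i j
    using arg_cong[OF eq, of "\<lambda>M. M $$ (i, j)"] assms that by (simp add: append_rows_def)
  moreover have "B $$ (i, j) = B' $$ (i, j)" if "i < b" "j < c" for i j
    using arg_cong[OF eq, of "\<lambda>M. M $$ (a + i, j)"] assms that by (simp add: append_rows_def)
  ultimately show "A = A' \<and> B = B'"
    using assms by (auto intro!: eq_matI)
qed simp

lemma append_rows_minus:
  fixes A B :: "'a :: group_add mat"
  assumes "A \<in> carrier_mat a c" "A' \<in> carrier_mat a c" "B \<in> carrier_mat b c" "B' \<in> carrier_mat b c"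
  shows "(A @\<^sub>r B) - (A' @\<^sub>r B') = (A - A') @\<^sub>r (B - B')"
  using assms by (intro eq_matI) (auto simp: append_rows_def)

lemma append_rows_split:
  assumes "Y \<in> carrier_mat (a + b) c"
  obtains Y1 Y2 where "Y1 \<in> carrier_mat a c" "Y2 \<in> carrier_mat b c" "Y = Y1 @\<^sub>r Y2"
proof
  show "mat a c (\<lambda>(i, j). Y $$ (i, j)) \<in> carrier_mat a c"
    "mat b c (\<lambda>(i, j). Y $$ (a + i, j)) \<in> carrier_mat b c"
    by auto
  show "Y = mat a c (\<lambda>(i, j). Y $$ (i, j)) @\<^sub>r mat b c (\<lambda>(i, j). Y $$ (a + i, j))"
    using assms by (intro eq_matI) (auto simp: append_rows_def)
qed

text \<open>The adjoint of an inverse of \<open>R\<close> inverts \<open>mat_adjoint R\<close>, so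
  \<open>mat_inverse\<close> succeeds and \<open>inv_mat\<close> yields a genuine two-sided
  inverse.\<close>

lemma mat_inverse_adjoint:
  fixes R :: "complex mat"
  assumes "R \<in> carrier_mat k k" "invertible_mat R"
  shows "inv_mat (mat_adjoint R) \<in> carrier_mat k k"
    and "mat_adjoint R * inv_mat (mat_adjoint R) = 1\<^sub>m k"
    and "inv_mat (mat_adjoint R) * mat_adjoint R = 1\<^sub>m k"
proof -
  obtain S where S: "R * S = 1\<^sub>m k" "S * R = 1\<^sub>m (dim_row S)"
    using assms by (auto simp: invertible_mat_def inverts_mat_def)
  \<comment> \<open>Invertibility supplies \<open>S\<close> without a carrier; its shape is read off
    from the two product identities.\<close>
  have "dim_col (R * S) = k" "dim_col (S * R) = dim_row S"
    unfolding S by simp_all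
  then have dims: "S \<in> carrier_mat k k"
    using assms by auto
  have "mat_adjoint S * mat_adjoint R = 1\<^sub>m k" "mat_adjoint R * mat_adjoint S = 1\<^sub>m k"
    using arg_cong[OF S(1), of mat_adjoint] arg_cong[OF S(2), of mat_adjoint] assms dims
    by (auto simp: mat_adjoint_mult)
  then have "mat_adjoint R \<in> Units (ring_mat TYPE(complex) k b)" for b :: unit
    using assms dims by (auto simp: Units_def ring_mat_def intro!: bexI[of _ "mat_adjoint S"] mat_adjoint_carrier)
  with mat_inverse(1)[OF mat_adjoint_carrier[OF assms(1)]]
  obtain T where "mat_inverse (mat_adjoint R) = Some T"
    by fastforce
  with mat_inverse(2)[OF mat_adjoint_carrier[OF assms(1)] this]
  show "inv_mat (mat_adjoint R) \<in> carrier_mat k k"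
    and "mat_adjoint R * inv_mat (mat_adjoint R) = 1\<^sub>m k"
    and "inv_mat (mat_adjoint R) * mat_adjoint R = 1\<^sub>m k"
    by auto
qed

section \<open>The Frobenius norm\<close>

lemma frob_norm_nonneg: "0 \<le> frob_norm M"
  by (simp add: frob_norm_def sum_nonneg)

lemma frob_norm_power2:
  "(frob_norm M)\<^sup>2 = (\<Sum>s<dim_row M. \<Sum>t<dim_col M. (norm (M $$ (s, t)))\<^sup>2)"
  by (simp add: frob_norm_def sum_nonneg)

lemma frob_norm_eq_0_iff:
  assumes "M \<in> carrier_mat r c"
  shows "frob_norm M = 0 \<longleftrightarrow> M = 0\<^sub>m r c"
proof -
  have "frob_norm M = 0 \<longleftrightarrow> (\<forall>s<r. \<forall>t<c. M $$ (s, t) = 0)"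
    using assms by (auto simp: frob_norm_def sum_nonneg_eq_0_iff sum_nonneg)
  also have "\<dots> \<longleftrightarrow> M = 0\<^sub>m r c"
    using assms by (auto intro!: eq_matI)
  finally show ?thesis .
qed

lemma frob_norm_minus_eq_0_iff:
  assumes "A \<in> carrier_mat r c" "B \<in> carrier_mat r c"
  shows "frob_norm (A - B) = 0 \<longleftrightarrow> A = B"
  using assms frob_norm_eq_0_iff[OF minus_carrier_mat[OF assms(2), of A]]
    mat_eq_iff_minus_zero[OF assms]
  by simp

text \<open>The right-hand side is the trace of the Gram matrix. Norm identities thereby reduce to
  identities between matrix products.\<close>

lemma frob_norm_power2_adjoint:
  fixes M :: "complex mat"
  shows "complex_of_real ((frob_norm M)\<^sup>2) = (\<Sum>t<dim_col M. (mat_adjoint M * M) $$ (t, t))"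
proof -
  have "complex_of_real ((frob_norm M)\<^sup>2) =
      (\<Sum>t<dim_col M. \<Sum>s<dim_row M. cnj (M $$ (s, t)) * M $$ (s, t))"
    unfolding frob_norm_power2
    by (subst sum.swap) (simp add: complex_norm_square mult.commute flip: of_real_power)
  also have "\<dots> = (\<Sum>t<dim_col M. (mat_adjoint M * M) $$ (t, t))"
    by (intro sum.cong refl) (auto simp: scalar_prod_def lessThan_atLeast0 intro!: sum.cong)
  finally show ?thesis .
qed

text \<open>The Gram matrix of \<open>U + V\<close> has two cross terms; one vanishes by
  \<open>orth\<close>, the other is its adjoint.\<close>

lemma frob_norm_pythagoras:
  fixes U V :: "complex mat"
  assumes U: "U \<in> carrier_mat r c" and V: "V \<in> carrier_mat r c"
    and orth: "mat_adjoint U * V = 0\<^sub>m c c"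
  shows "(frob_norm (U + V))\<^sup>2 = (frob_norm U)\<^sup>2 + (frob_norm V)\<^sup>2"
proof -
  have orth': "mat_adjoint V * U = 0\<^sub>m c c"
    using arg_cong[OF orth, of mat_adjoint] U V by (simp add: mat_adjoint_mult)
  have "mat_adjoint (U + V) * (U + V) = mat_adjoint U * U + mat_adjoint V * V"
  proof -
    have "mat_adjoint (U + V) * (U + V) =
        (mat_adjoint U * U + mat_adjoint V * U) + (mat_adjoint U * V + mat_adjoint V * V)"
      using U V by (simp add: mat_dim_simps)
    also have "\<dots> = mat_adjoint U * U + mat_adjoint V * V"
      unfolding orth orth' using U V by (intro eq_matI) auto
    finally show ?thesis .
  qed
  then have "complex_of_real ((frob_norm (U + V))\<^sup>2) =
      complex_of_real ((frob_norm U)\<^sup>2 + (frob_norm V)\<^sup>2)"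
    unfolding of_real_add frob_norm_power2_adjoint using U V by (simp add: sum.distrib)
  then show ?thesis
    unfolding of_real_eq_iff .
qed

text \<open>In the Gram matrix of \<open>Q * Y\<close> the inner factor
  \<open>mat_adjoint Q * Q\<close> cancels.\<close>

lemma frob_norm_unitary_mult:
  fixes Q Y :: "complex mat"
  assumes "Q \<in> carrier_mat k k" "mat_adjoint Q * Q = 1\<^sub>m k" "Y \<in> carrier_mat k c"
  shows "(frob_norm (Q * Y))\<^sup>2 = (frob_norm Y)\<^sup>2"
proof -
  have "mat_adjoint (Q * Y) * (Q * Y) = mat_adjoint Y * (mat_adjoint Q * Q) * Y"
    using assms(1,3) by (simp add: mat_dim_simps)
  also have "\<dots> = mat_adjoint Y * Y"
    unfolding assms(2) using assms(3) by (simp add: mat_dim_simps)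
  finally have "complex_of_real ((frob_norm (Q * Y))\<^sup>2) = complex_of_real ((frob_norm Y)\<^sup>2)"
    unfolding frob_norm_power2_adjoint using assms(1,3) by simp
  then show ?thesis
    unfolding of_real_eq_iff .
qed

lemma frob_norm_append_rows:
  assumes "U \<in> carrier_mat a c" "V \<in> carrier_mat b c"
  shows "(frob_norm (U @\<^sub>r V))\<^sup>2 = (frob_norm U)\<^sup>2 + (frob_norm V)\<^sup>2"
proof -
  have "(frob_norm (U @\<^sub>r V))\<^sup>2 = (\<Sum>s<a + b. \<Sum>t<c. (norm ((U @\<^sub>r V) $$ (s, t)))\<^sup>2)"
    using assms by (simp add: frob_norm_power2 append_rows_def)
  also have "\<dots> = (\<Sum>s<a. \<Sum>t<c. (norm ((U @\<^sub>r V) $$ (s, t)))\<^sup>2) +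
      (\<Sum>s<b. \<Sum>t<c. (norm ((U @\<^sub>r V) $$ (a + s, t)))\<^sup>2)"
    by (induction b) (simp_all add: add.assoc)
  also have "\<dots> = (frob_norm U)\<^sup>2 + (frob_norm V)\<^sup>2"
    using assms by (simp add: frob_norm_power2 append_rows_def)
  finally show ?thesis .
qed

section \<open>The Moore-Penrose inverse\<close>

text \<open>If \<open>P G\<close> does not yet fix \<open>a = P e\<close>, then adding \<open>(e - G a) b'\<close> to \<open>G\<close> repairs this, for
  a row \<open>b'\<close> that annihilates the vectors already fixed and satisfies \<open>b' a = 1\<close>.\<close>

lemma inner_inverse_on_family:
  fixes P :: "'a :: field mat" and k :: nat
  assumes P: "P \<in> carrier_mat m n" and E: "\<And>j. E j \<in> carrier_mat n 1"
  shows "\<exists>G \<in> carrier_mat n m. \<forall>j<k. P * (G * (P * E j)) = P * E j"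
proof (induction k)
  case 0
  show ?case by (auto intro: bexI[of _ "0\<^sub>m n m"])
next
  case (Suc k)
  then obtain G where G: "G \<in> carrier_mat n m"
    and GE: "\<And>j. j < k \<Longrightarrow> P * (G * (P * E j)) = P * E j"
    by blast
  define a where "a = P * E k"
  define c where "c = a - P * (G * a)"
  have dims: "dim_row P = m" "dim_col P = n" "dim_row G = n" "dim_col G = m"
    "dim_row (E j) = n" "dim_col (E j) = 1" for j
    using P G E[of j] by auto
  have dac: "dim_row a = m" "dim_col a = 1" "dim_row c = m" "dim_col c = 1"
    by (auto simp: a_def c_def dims)
  show ?case
  proof (cases "c = 0\<^sub>m m 1")
    \<comment> \<open>Here \<open>a\<close> is already fixed by \<open>P * G\<close>, so the old
      \<open>G\<close> serves for \<open>Suc k\<close> as well.\<close>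
    case True
    then have "P * (G * a) = a"
      unfolding c_def by (subst eq_commute, subst mat_eq_iff_minus_zero[of _ m 1]) (auto simp: dims dac)
    then show ?thesis
      using G GE by (auto simp: less_Suc_eq a_def)
  next
    case False
    have "\<exists>i<m. c $$ (i, 0) \<noteq> 0"
    proof (rule ccontr)
      assume "\<not> (\<exists>i<m. c $$ (i, 0) \<noteq> 0)"
      then have "c = 0\<^sub>m m 1"
        using dac by (intro eq_matI) auto
      with False show False ..
    qed
    then obtain i where i: "i < m" "c $$ (i, 0) \<noteq> 0"
      by blast
    \<comment> \<open>This row reads off a nonzero entry of \<open>c\<close> and rescales it to 1.
      Composing it with \<open>1 - P * G\<close> gives \<open>b'\<close>, which kills every fixed
      vector and sends \<open>a\<close> to \<open>b * c = 1\<close>.\<close>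
    define b where "b = mat 1 m (\<lambda>(_, j). if j = i then 1 / c $$ (i, 0) else 0)"
    have db: "dim_row b = 1" "dim_col b = m"
      by (auto simp: b_def)
    have bc: "b * c = 1\<^sub>m 1"
      using i dac by (intro eq_matI) (auto simp: b_def scalar_prod_def if_distrib[where f = "\<lambda>x. x * c" for c] cong: if_cong)
    define b' where "b' = b - b * (P * G)"
    have db': "dim_row b' = 1" "dim_col b' = m"
      by (auto simp: b'_def db dims)
    have b'E: "b' * (P * E j) = 0\<^sub>m 1 1" if "j < k" for j
    proof -
      have "b' * (P * E j) = b * (P * E j) - b * (P * (G * (P * E j)))"
        by (simp add: b'_def mat_dim_simps db dims)
      then show ?thesis
        unfolding GE[OF that] by (auto simp: dims db)
    qed
    have b'a: "b' * a = 1\<^sub>m 1"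
      unfolding bc[symmetric] by (simp add: b'_def c_def mat_dim_simps db dims dac)
    let ?G = "G + (E k - G * a) * b'"
    \<comment> \<open>Since \<open>P * E k = a\<close>, the update of \<open>G\<close> contributes
      \<open>c * (b' * x)\<close>: zero on the vectors fixed before, and exactly the missing
      \<open>c = a - P * (G * a)\<close> at \<open>x = a\<close>.\<close>
    have split: "P * (?G * x) = P * (G * x) + c * (b' * x)" if "dim_row x = m" for x
    proof -
      have "P * (E k * (b' * x)) = a * (b' * x)"
        by (simp add: a_def mat_assoc_dim db' dims)
      then show ?thesis
        by (simp add: mat_dim_simps db' dims dac that c_def)
    qed
    have "P * (?G * (P * E j)) = P * E j" if "j < Suc k" for j
    proof (cases "j = k")
      case True
      show ?thesis
        unfolding True a_def[symmetric]
        by (subst split) (auto simp: b'a dac mat_dim_simps c_def dims)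
    next
      case False
      then have "j < k" using that by simp
      then show ?thesis
        by (subst split) (auto simp: b'E GE mat_dim_simps dac dims)
    qed
    moreover have "?G \<in> carrier_mat n m"
      by (auto simp: dims db')
    ultimately show ?thesis
      by blast
  qed
qed

text \<open>The family is taken to be the standard basis. Multiplying by \<open>E j\<close> extracts
  column \<open>j\<close>, so fixing all \<open>P * E j\<close> amounts to
  \<open>P * G * P = P\<close>, column by column.\<close>

lemma inner_inverse_exists:
  fixes P :: "'a :: field mat"
  assumes P: "P \<in> carrier_mat m n"
  obtains G where "G \<in> carrier_mat n m" "P * G * P = P"
proof -
  define E :: "nat \<Rightarrow> 'a mat" where "E = (\<lambda>j. mat n 1 (\<lambda>(i, _). if i = j then 1 else 0))"
  have E: "E j \<in> carrier_mat n 1" for j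
    by (auto simp: E_def)
  have ME: "(M * E j) $$ (i, 0) = M $$ (i, j)" if "M \<in> carrier_mat m n" "i < m" "j < n" for M i j
    using that by (simp add: E_def scalar_prod_def if_distrib[where f = "\<lambda>x. c * x" for c] cong: if_cong)
  obtain G where G: "G \<in> carrier_mat n m"
    and GE: "\<And>j. j < n \<Longrightarrow> P * (G * (P * E j)) = P * E j"
    using inner_inverse_on_family[of P m n E n, OF P E] by auto
  have "(P * G * P) $$ (i, j) = P $$ (i, j)" if ij: "i < m" "j < n" for i j
  proof -
    have "P * G * P * E j = P * (G * (P * E j))"
      using P G E[of j] by (simp add: mat_dim_simps)
    then show ?thesis
      using ME[of "P * G * P" i j] ME[of P i j] GE[of j] P G ij by simp
  qed
  then have "P * G * P = P"
    using P G by (intro eq_matI) auto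
  with G that show thesis
    by blast
qed

text \<open>For any inner inverse \<open>K\<close> of the Gram matrix \<open>P\<^sup>H P\<close>, the product \<open>P K P\<^sup>H\<close> is the
  orthogonal projection onto the range of \<open>P\<close>.\<close>

lemma hermitian_inner_inverse_exists:
  fixes P :: "complex mat"
  assumes P: "P \<in> carrier_mat m n"
  obtains G where "G \<in> carrier_mat n m" "P * G * P = P" "mat_adjoint (P * G) = P * G"
proof -
  define H where "H = mat_adjoint P * P"
  have H: "H \<in> carrier_mat n n"
    using P by (auto simp: H_def)
  obtain K where K: "K \<in> carrier_mat n n" and HKH: "H * K * H = H"
    using inner_inverse_exists[OF H] by blast
  have dims: "dim_row P = m" "dim_col P = n" "dim_row K = n" "dim_col K = n" "dim_row H = n" "dim_col H = n"
    using P K H by auto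
  \<comment> \<open>Goal: \<open>P * K * H = P\<close>. The columns of \<open>Z\<close> lie in the
    range of \<open>P\<close> and are annihilated by \<open>mat_adjoint P\<close>, so the Gram
    matrix of \<open>Z\<close> vanishes and \<open>Z = 0\<close>.\<close>
  define Z where "Z = P * K * H - P"
  have dZ: "dim_row Z = m" "dim_col Z = n"
    by (auto simp: Z_def dims)
  have PZ: "mat_adjoint P * Z = 0\<^sub>m n n"
  proof -
    have "mat_adjoint P * Z = H * K * H - H"
      by (simp add: Z_def H_def mat_dim_simps dims)
    then show ?thesis
      unfolding HKH by (simp add: minus_r_inv_mat[OF H])
  qed
  have "mat_adjoint Z * Z = mat_adjoint (K * H) * (mat_adjoint P * Z) - mat_adjoint P * Z"
  proof -
    have "mat_adjoint Z = mat_adjoint (K * H) * mat_adjoint P - mat_adjoint P"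
      by (simp add: Z_def mat_dim_simps dims)
    then show ?thesis
      by (simp add: mat_dim_simps dims dZ)
  qed
  also have "\<dots> = 0\<^sub>m n n"
    unfolding PZ by (auto simp: dims mat_dim_simps)
  finally have "frob_norm Z = 0"
    using frob_norm_power2_adjoint[of Z] by (simp add: dZ)
  then have "Z = 0\<^sub>m m n"
    using frob_norm_eq_0_iff[of Z m n] dZ by auto
  then have PKH: "P * K * H = P"
    unfolding Z_def by (subst mat_eq_iff_minus_zero[of _ m n]) (auto simp: dims)
  have adjP: "mat_adjoint P = H * mat_adjoint K * mat_adjoint P"
    by (subst PKH[symmetric]) (simp add: H_def mat_dim_simps dims)
  show thesis
  proof
    show "K * mat_adjoint P \<in> carrier_mat n m"
      by (auto simp: dims)
    show "P * (K * mat_adjoint P) * P = P"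
      using PKH by (simp add: H_def mat_dim_simps dims)
    \<comment> \<open>\<open>K\<close> need not be Hermitian. Replacing \<open>mat_adjoint P\<close>
      by \<open>adjP\<close> makes \<open>P * K * H\<close> appear, which collapses to
      \<open>P\<close> and leaves the product with \<open>mat_adjoint K\<close> in place of
      \<open>K\<close>, that is, the adjoint.\<close>
    have "P * (K * mat_adjoint P) = P * K * (H * mat_adjoint K * mat_adjoint P)"
      unfolding adjP[symmetric] by (simp add: mat_dim_simps dims)
    also have "\<dots> = P * K * H * (mat_adjoint K * mat_adjoint P)"
      by (simp add: mat_dim_simps dims)
    also have "\<dots> = mat_adjoint (P * (K * mat_adjoint P))"
      unfolding PKH by (simp add: mat_dim_simps dims)
    finally show "mat_adjoint (P * (K * mat_adjoint P)) = P * (K * mat_adjoint P)"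
      by simp
  qed
qed

text \<open>Take inner inverses \<open>G\<close> and \<open>F\<close> with \<open>P * G\<close> and
  \<open>F * P\<close> Hermitian; then \<open>F * P * G\<close> satisfies all four Penrose
  equations. \<open>F\<close> arises by applying the one-sided construction to
  \<open>mat_adjoint P\<close> and taking the adjoint.\<close>

lemma is_pinv_exists: "\<exists>G. is_pinv P G"
proof -
  define m n where "m = dim_row P" and "n = dim_col P"
  have P: "P \<in> carrier_mat m n"
    by (auto simp: m_def n_def)
  obtain G where G: "G \<in> carrier_mat n m" "P * G * P = P" "mat_adjoint (P * G) = P * G"
    using hermitian_inner_inverse_exists[OF P] .
  obtain F0 where F0: "F0 \<in> carrier_mat m n" "mat_adjoint P * F0 * mat_adjoint P = mat_adjoint P"
    "mat_adjoint (mat_adjoint P * F0) = mat_adjoint P * F0"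
    using hermitian_inner_inverse_exists[OF mat_adjoint_carrier[OF P]] .
  define F where "F = mat_adjoint F0"
  have dims: "dim_row P = m" "dim_col P = n" "dim_row G = n" "dim_col G = m" "dim_row F = n" "dim_col F = m"
    "dim_row F0 = m" "dim_col F0 = n"
    using P G(1) F0(1) by (auto simp: F_def)
  have PFP: "P * F * P = P"
    using arg_cong[OF F0(2), of mat_adjoint] by (simp add: F_def mat_dim_simps dims)
  have FP: "mat_adjoint (F * P) = F * P"
    using F0(3) by (simp add: F_def mat_dim_simps dims)
  let ?X = "F * P * G"
  have PX: "P * ?X = P * G"
  proof -
    have "P * ?X = P * F * P * G"
      by (simp add: mat_dim_simps dims)
    then show ?thesis
      unfolding PFP .
  qed
  have XP: "?X * P = F * P"
  proof -
    have "?X * P = F * (P * G * P)"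
      by (simp add: mat_dim_simps dims)
    then show ?thesis
      unfolding G(2) .
  qed
  have "?X * P * ?X = F * (P * ?X)"
    unfolding XP by (simp add: mat_dim_simps dims)
  then have "?X * P * ?X = ?X"
    unfolding PX by (simp add: mat_dim_simps dims)
  moreover have "?X \<in> carrier_mat (dim_col P) (dim_row P)"
    by (auto simp: dims)
  ultimately have "is_pinv P ?X"
    unfolding is_pinv_def PX XP using G(2,3) FP by blast
  then show ?thesis ..
qed

text \<open>\<open>P * G\<close> and \<open>P * H\<close> are both the orthogonal projection onto
  the range of \<open>P\<close>, hence equal; symmetrically \<open>G * P = H * P\<close>. Then
  \<open>G = G * P * G = H * P * G = H * P * H = H\<close>.\<close>

lemma is_pinv_unique:
  assumes G: "is_pinv P G" and H: "is_pinv P H"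
  shows "G = H"
proof -
  have dims: "dim_row G = dim_col P" "dim_col G = dim_row P" "dim_row H = dim_col P" "dim_col H = dim_row P"
    using G H by (auto simp: is_pinv_def)
  have g: "P * G * P = P" "G * P * G = G" "mat_adjoint (P * G) = P * G" "mat_adjoint (G * P) = G * P"
    and h: "P * H * P = P" "H * P * H = H" "mat_adjoint (P * H) = P * H" "mat_adjoint (H * P) = H * P"
    using G H by (auto simp: is_pinv_def)
  have "P * G = P * H * P * G"
    unfolding h(1) ..
  also have "\<dots> = (P * H) * (P * G)"
    by (simp add: mat_dim_simps dims)
  also have "\<dots> = mat_adjoint (P * H) * mat_adjoint (P * G)"
    unfolding g(3) h(3) ..
  also have "\<dots> = mat_adjoint (P * G * (P * H))"
    by (rule mat_adjoint_mult[symmetric]) (simp add: dims)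
  also have "P * G * (P * H) = P * G * P * H"
    by (simp add: mat_dim_simps dims)
  also have "mat_adjoint \<dots> = P * H"
    unfolding g(1) h(3) ..
  finally have PG: "P * G = P * H" .
  have "G * P = G * (P * H * P)"
    unfolding h(1) ..
  also have "\<dots> = (G * P) * (H * P)"
    by (simp add: mat_dim_simps dims)
  also have "\<dots> = mat_adjoint (G * P) * mat_adjoint (H * P)"
    unfolding g(4) h(4) ..
  also have "\<dots> = mat_adjoint (H * P * (G * P))"
    by (rule mat_adjoint_mult[symmetric]) (simp add: dims)
  also have "H * P * (G * P) = H * (P * G * P)"
    by (simp add: mat_dim_simps dims)
  also have "mat_adjoint \<dots> = H * P"
    unfolding g(1) h(4) ..
  finally have GP: "G * P = H * P" .
  have "G = H * P * G"
    using g(2) GP by simp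
  also have "\<dots> = H * (P * G)"
    by (simp add: mat_dim_simps dims)
  also have "\<dots> = H * P * H"
    unfolding PG by (simp add: mat_dim_simps dims)
  also have "\<dots> = H"
    by (rule h(2))
  finally show ?thesis .
qed

lemma is_pinv_pinv: "is_pinv P (pinv P)"
  unfolding pinv_def by (rule theI') (use is_pinv_exists is_pinv_unique in blast)

lemma pinv_carrier: "P \<in> carrier_mat r k \<Longrightarrow> pinv P \<in> carrier_mat k r"
  using is_pinv_pinv[of P] by (auto simp: is_pinv_def)

section \<open>Least squares\<close>

text \<open>With \<open>G = pinv P\<close>, the equations \<open>P * G * P = P\<close> and
  \<open>mat_adjoint (P * G) = P * G\<close> make the residual of \<open>G * W\<close> orthogonal to
  the range of \<open>P\<close>, where the remaining difference \<open>P * (Y - G * W)\<close>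
  lies.\<close>

lemma lstsq_residual:
  assumes P: "P \<in> carrier_mat r k" and W: "W \<in> carrier_mat r d" and Y: "Y \<in> carrier_mat k d"
  shows "(frob_norm (P * Y - W))\<^sup>2 =
    (frob_norm (P * (pinv P * W) - W))\<^sup>2 + (frob_norm (P * Y - P * (pinv P * W)))\<^sup>2"
proof -
  define G where "G = pinv P"
  have G: "P * G * P = P" "mat_adjoint (P * G) = P * G"
    using is_pinv_pinv[of P] by (auto simp: is_pinv_def G_def)
  have dims: "dim_row P = r" "dim_col P = k" "dim_row W = r" "dim_col W = d" "dim_row Y = k" "dim_col Y = d"
    "dim_row G = k" "dim_col G = r"
    using P W Y pinv_carrier[OF P] by (auto simp: G_def)
  let ?U = "P * (G * W) - W" and ?V = "P * Y - P * (G * W)"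
  have "mat_adjoint ?U * P = mat_adjoint (P * G * W) * P - mat_adjoint W * P"
    by (simp add: mat_dim_simps dims)
  also have "mat_adjoint (P * G * W) * P = mat_adjoint W * mat_adjoint (P * G) * P"
    by (subst mat_adjoint_mult[of "P * G" W]) (simp_all add: dims)
  also have "\<dots> = mat_adjoint W * (P * G * P)"
    unfolding G(2) by (simp add: mat_dim_simps dims)
  also have "\<dots> - mat_adjoint W * P = 0\<^sub>m d k"
    unfolding G(1) by (auto simp: dims)
  finally have UP: "mat_adjoint ?U * P = 0\<^sub>m d k" .
  have "mat_adjoint ?U * ?V = mat_adjoint ?U * P * (Y - G * W)"
    by (simp add: mat_assoc_dim mat_distrib_dim(2) dims)
  also have "\<dots> = 0\<^sub>m d d"
    unfolding UP by (simp add: mat_dim_simps dims)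
  finally have orth: "mat_adjoint ?U * ?V = 0\<^sub>m d d" .
  have "?U + ?V = P * Y - W"
    by (intro eq_matI) (auto simp: dims)
  moreover have "?U \<in> carrier_mat r d" "?V \<in> carrier_mat r d"
    by (intro carrier_matI; simp add: dims)+
  ultimately show ?thesis
    using frob_norm_pythagoras[OF _ _ orth] by (simp add: G_def)
qed

text \<open>By \<open>sol\<close>, \<open>Y\<close> differs from \<open>pinv P * W\<close> by an
  element of the kernel of \<open>P\<close>, to which \<open>pinv P * W\<close> is orthogonal. This
  rests on the other two Penrose equations.\<close>

lemma lstsq_solution_norm:
  assumes P: "P \<in> carrier_mat r k" and W: "W \<in> carrier_mat r d" and Y: "Y \<in> carrier_mat k d"
    and sol: "P * Y = P * (pinv P * W)"
  shows "(frob_norm Y)\<^sup>2 = (frob_norm (pinv P * W))\<^sup>2 + (frob_norm (Y - pinv P * W))\<^sup>2"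
proof -
  define G where "G = pinv P"
  have G: "G * P * G = G" "mat_adjoint (G * P) = G * P"
    using is_pinv_pinv[of P] by (auto simp: is_pinv_def G_def)
  have dims: "dim_row P = r" "dim_col P = k" "dim_row W = r" "dim_col W = d" "dim_row Y = k" "dim_col Y = d"
    "dim_row G = k" "dim_col G = r"
    using P W Y pinv_carrier[OF P] by (auto simp: G_def)
  let ?V = "Y - G * W"
  have "P * ?V = P * Y - P * (G * W)"
    by (simp add: mat_dim_simps dims)
  also have "\<dots> = 0\<^sub>m r d"
    unfolding sol G_def[symmetric] by (auto simp: dims)
  finally have PV: "P * ?V = 0\<^sub>m r d" .
  \<comment> \<open>Inserting \<open>G = G * P * G\<close> and moving the Hermitian factor
    \<open>G * P\<close> to the right brings \<open>P\<close> next to \<open>?V\<close>, where the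
    product is zero.\<close>
  have "mat_adjoint (G * W) = mat_adjoint (G * P * (G * W))"
    by (subst G(1)[symmetric]) (simp add: mat_assoc_dim dims)
  also have "\<dots> = mat_adjoint (G * W) * (G * P)"
    by (subst mat_adjoint_mult[of "G * P"]) (simp_all add: dims G(2))
  finally have "mat_adjoint (G * W) * ?V = mat_adjoint (G * W) * (G * P) * ?V"
    by simp
  also have "\<dots> = mat_adjoint (G * W) * (G * (P * ?V))"
    by (simp add: mat_assoc_dim dims)
  also have "\<dots> = 0\<^sub>m d d"
    unfolding PV by (simp add: mat_dim_simps dims)
  finally have orth: "mat_adjoint (G * W) * ?V = 0\<^sub>m d d" .
  have "G * W + ?V = Y"
    by (intro eq_matI) (auto simp: dims)
  moreover have "G * W \<in> carrier_mat k d" "?V \<in> carrier_mat k d"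
    by (intro carrier_matI; simp add: dims)+
  ultimately show ?thesis
    using frob_norm_pythagoras[OF _ _ orth] by (simp add: G_def)
qed

text \<open>The squared objective is a constant plus the squared distance from \<open>P * Y\<close>
  to \<open>P * (pinv P * W)\<close>, so it is least exactly when that distance is zero.\<close>

lemma lstsq_arg_min_iff:
  assumes P: "P \<in> carrier_mat r k" and W: "W \<in> carrier_mat r d" and Y: "Y \<in> carrier_mat k d"
  shows "(\<forall>Z \<in> carrier_mat k d. frob_norm (P * Y - W) \<le> frob_norm (P * Z - W)) \<longleftrightarrow>
    P * Y = P * (pinv P * W)"
proof
  have GW: "pinv P * W \<in> carrier_mat k d"
    using pinv_carrier[OF P] W by auto
  assume "\<forall>Z \<in> carrier_mat k d. frob_norm (P * Y - W) \<le> frob_norm (P * Z - W)"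
  then have "frob_norm (P * Y - W) \<le> frob_norm (P * (pinv P * W) - W)"
    using GW by blast
  then have "(frob_norm (P * Y - W))\<^sup>2 \<le> (frob_norm (P * (pinv P * W) - W))\<^sup>2"
    by (intro power_mono frob_norm_nonneg)
  then have "frob_norm (P * Y - P * (pinv P * W)) = 0"
    using lstsq_residual[OF assms] by simp
  then show "P * Y = P * (pinv P * W)"
    using frob_norm_minus_eq_0_iff[of "P * Y" r d "P * (pinv P * W)"] P Y GW by simp
next
  assume eq: "P * Y = P * (pinv P * W)"
  show "\<forall>Z \<in> carrier_mat k d. frob_norm (P * Y - W) \<le> frob_norm (P * Z - W)"
  proof
    fix Z :: "complex mat"
    assume "Z \<in> carrier_mat k d"
    from lstsq_residual[OF P W this] have "(frob_norm (P * Y - W))\<^sup>2 \<le> (frob_norm (P * Z - W))\<^sup>2"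
      unfolding eq by simp
    then show "frob_norm (P * Y - W) \<le> frob_norm (P * Z - W)"
      by (rule power2_le_imp_le[OF _ frob_norm_nonneg])
  qed
qed

section \<open>Reduced biquaternion matrices acting on complex matrices\<close>

text \<open>Embedded complex numbers commute with \<open>rbq_j\<close>, so multiplication by them
  acts on the two complex coordinates separately. This is what makes \<open>block_col\<close>
  compatible with complex factors.\<close>

lemma rbq_c1_add: "rbq_c1 (x + y) = rbq_c1 x + rbq_c1 y"
  and rbq_c2_add: "rbq_c2 (x + y) = rbq_c2 x + rbq_c2 y"
  and rbq_c1_diff: "rbq_c1 (x - y) = rbq_c1 x - rbq_c1 y"
  and rbq_c2_diff: "rbq_c2 (x - y) = rbq_c2 x - rbq_c2 y"
  and rbq_c1_mult_of_complex: "rbq_c1 (x * rbq_of_complex z) = rbq_c1 x * z"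
  and rbq_c2_mult_of_complex: "rbq_c2 (x * rbq_of_complex z) = rbq_c2 x * z"
  and rbq_c1_zero: "rbq_c1 0 = 0"
  and rbq_c2_zero: "rbq_c2 0 = 0"
  by (auto simp: rbq_c1_def rbq_c2_def plus_rbq_def minus_rbq_def times_rbq_def zero_rbq_def
      rbq_of_complex_def complex_eq_iff algebra_simps)

lemma rbq_c1_sum: "rbq_c1 (sum f I) = (\<Sum>i\<in>I. rbq_c1 (f i))"
  and rbq_c2_sum: "rbq_c2 (sum f I) = (\<Sum>i\<in>I. rbq_c2 (f i))"
  by (induction I rule: infinite_finite_induct)
    (simp_all add: rbq_c1_zero rbq_c2_zero rbq_c1_add rbq_c2_add)

lemma rbq_eqI: "rbq_c1 x = rbq_c1 y \<Longrightarrow> rbq_c2 x = rbq_c2 y \<Longrightarrow> x = y"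
  using rbq_decomp[of x] rbq_decomp[of y] by simp

lemma block_col_carrier: "M \<in> carrier_mat r c \<Longrightarrow> block_col M \<in> carrier_mat (2 * r) c"
  by (auto simp: block_col_def append_rows_def)

lemma block_col_inject:
  assumes "M \<in> carrier_mat r c" "N \<in> carrier_mat r c"
  shows "block_col M = block_col N \<longleftrightarrow> M = N"
proof
  assume "block_col M = block_col N"
  then have *: "map_mat rbq_c1 M = map_mat rbq_c1 N" "map_mat rbq_c2 M = map_mat rbq_c2 N"
    using append_rows_inject[of "map_mat rbq_c1 M" r c "map_mat rbq_c1 N" "map_mat rbq_c2 M" r
        "map_mat rbq_c2 N"] assms
    by (auto simp: block_col_def)
  have "M $$ (i, j) = N $$ (i, j)" if "i < r" "j < c" for i j
    using arg_cong[OF *(1), of "\<lambda>M. M $$ (i, j)"] arg_cong[OF *(2), of "\<lambda>M. M $$ (i, j)"] assms that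
    by (auto intro: rbq_eqI)
  then show "M = N"
    using assms by (intro eq_matI) auto
qed simp

lemma block_col_mult:
  assumes "M \<in> carrier_mat r k" "X \<in> carrier_mat k c"
  shows "block_col (M * rbq_mat X) = block_col M * X"
proof -
  have "map_mat rbq_c1 (M * rbq_mat X) = map_mat rbq_c1 M * X"
    "map_mat rbq_c2 (M * rbq_mat X) = map_mat rbq_c2 M * X"
    using assms by (auto intro!: eq_matI sum.cong
        simp: scalar_prod_def rbq_c1_sum rbq_c2_sum rbq_c1_mult_of_complex rbq_c2_mult_of_complex)
  then show ?thesis
    unfolding block_col_def using assms by (subst append_rows_mult[of _ r k _ r _ c]) auto
qed

lemma block_col_minus:
  assumes "M \<in> carrier_mat r c" "N \<in> carrier_mat r c"
  shows "block_col (M - N) = block_col M - block_col N"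
proof -
  have "map_mat rbq_c1 (M - N) = map_mat rbq_c1 M - map_mat rbq_c1 N"
    "map_mat rbq_c2 (M - N) = map_mat rbq_c2 M - map_mat rbq_c2 N"
    using assms by (auto intro!: eq_matI simp: rbq_c1_diff rbq_c2_diff)
  then show ?thesis
    unfolding block_col_def using assms by (subst append_rows_minus[of _ r c _ _ r]) auto
qed

lemma frob_norm_block_col: "frob_norm (block_col M) = frob_norm M"
proof -
  have "(frob_norm (block_col M))\<^sup>2 =
      (frob_norm (map_mat rbq_c1 M))\<^sup>2 + (frob_norm (map_mat rbq_c2 M))\<^sup>2"
    unfolding block_col_def
    by (rule frob_norm_append_rows[of _ "dim_row M" "dim_col M" _ "dim_row M"]) auto
  also have "\<dots> = (frob_norm M)\<^sup>2"
    unfolding frob_norm_power2 by (simp add: norm_rbq_complex sum.distrib)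
  finally show ?thesis
    by (simp add: frob_norm_nonneg)
qed

text \<open>Injectivity of \<open>block_col\<close> matches the constraints, its isometry the
  objectives. Equality of predicates, rather than pointwise equivalence on a carrier, allows
  rewriting beneath the outer \<open>is_arg_min\<close> for the minimum norm.\<close>

lemma rblse_solution_eq_lse_solution:
  assumes A: "A \<in> carrier_mat m n" and B: "B \<in> carrier_mat m d"
    and C: "C \<in> carrier_mat p n" and D: "D \<in> carrier_mat p d"
  shows "rblse_solution n d A B C D =
    lse_solution n d (block_col A) (block_col B) (block_col C) (block_col D)"
proof -
  have feas: "(X \<in> carrier_mat n d \<and> C * rbq_mat X = D) \<longleftrightarrow>
      (X \<in> carrier_mat n d \<and> block_col C * X = block_col D)" for X
    using block_col_mult[OF C, of X d] block_col_inject[of "C * rbq_mat X" p d D] C D by auto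
  have obj: "frob_norm (A * rbq_mat X - B) = frob_norm (block_col A * X - block_col B)"
    if "X \<in> carrier_mat n d" for X
  proof -
    have "block_col (A * rbq_mat X - B) = block_col A * X - block_col B"
      using that A B by (subst block_col_minus[of _ m d]) (auto simp: block_col_mult)
    then show ?thesis
      by (metis frob_norm_block_col)
  qed
  show ?thesis
    unfolding rblse_solution_def lse_solution_def is_arg_min_def feas using obj by (auto simp: fun_eq_iff)
qed

section \<open>The null space method\<close>

text \<open>The factorization gives \<open>K * Q\<close> the block form [R^H, 0]. In the coordinates
  [Y1; Y2] of \<open>mat_adjoint Q * X\<close> the constraint thus reads R^H Y1 = L, which fixes
  \<open>Y1\<close> and leaves \<open>Y2\<close> free.\<close>

lemma lse_feasible_iff:
  fixes K L Q R :: "complex mat"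
  assumes Q: "Q \<in> carrier_mat n n" "unitary_mat Q" and R: "R \<in> carrier_mat q q" "invertible_mat R"
    and L: "L \<in> carrier_mat q d" and qn: "q \<le> n"
    and K: "mat_adjoint K = Q * (R @\<^sub>r 0\<^sub>m (n - q) q)"
  shows "X \<in> carrier_mat n d \<and> K * X = L \<longleftrightarrow>
    (\<exists>Y \<in> carrier_mat (n - q) d. X = Q * ((inv_mat (mat_adjoint R) * L) @\<^sub>r Y))"
proof -
  define T where "T = inv_mat (mat_adjoint R) * L"
  note inv = mat_inverse_adjoint[OF R]
  have T: "T \<in> carrier_mat q d"
    using inv(1) L by (auto simp: T_def)
  have QQ: "Q * mat_adjoint Q = 1\<^sub>m n" "mat_adjoint Q * Q = 1\<^sub>m n"
    using Q by (auto simp: unitary_mat_def inverts_mat_def)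
  have RZ: "R @\<^sub>r 0\<^sub>m (n - q) q \<in> carrier_mat n q"
    using carrier_append_rows[OF R(1), of "0\<^sub>m (n - q) q" "n - q"] qn by simp
  have KQY: "K * (Q * (Y1 @\<^sub>r Y2)) = mat_adjoint R * Y1"
    if Y1: "Y1 \<in> carrier_mat q d" and Y2: "Y2 \<in> carrier_mat (n - q) d" for Y1 Y2
  proof -
    have Y: "Y1 @\<^sub>r Y2 \<in> carrier_mat n d"
      using carrier_append_rows[OF Y1 Y2] qn by simp
    have "K = mat_adjoint (R @\<^sub>r 0\<^sub>m (n - q) q) * mat_adjoint Q"
      using arg_cong[OF K, of mat_adjoint] Q(1) RZ by (simp add: mat_adjoint_mult)
    then have "K * (Q * (Y1 @\<^sub>r Y2)) =
        mat_adjoint (R @\<^sub>r 0\<^sub>m (n - q) q) * (mat_adjoint Q * Q * (Y1 @\<^sub>r Y2))"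
      using Q(1) RZ Y by (simp add: mat_assoc_dim)
    also have "\<dots> = (mat_adjoint R @\<^sub>c mat_adjoint (0\<^sub>m (n - q) q)) * (Y1 @\<^sub>r Y2)"
      unfolding QQ using Y R by (simp add: mat_one_mult_dim mat_adjoint_append_rows[of _ q q _ "n - q"])
    also have "\<dots> = mat_adjoint R * Y1 + mat_adjoint (0\<^sub>m (n - q) q) * Y2"
      using R Y1 Y2 by (intro append_cols_mult_append_rows) (auto intro: mat_adjoint_carrier)
    also have "\<dots> = mat_adjoint R * Y1"
      using R Y1 Y2 by (auto simp: mat_zero_mult_dim)
    finally show ?thesis .
  qed
  show ?thesis
    unfolding T_def[symmetric]
  proof
    assume "X \<in> carrier_mat n d \<and> K * X = L"
    then have X: "X \<in> carrier_mat n d" "K * X = L"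
      by auto
    \<comment> \<open>\<open>qn\<close> turns \<open>q + (n - q)\<close> into \<open>n\<close>
      despite truncated subtraction, so the coordinates can be split after row
      \<open>q\<close>.\<close>
    have "mat_adjoint Q * X \<in> carrier_mat (q + (n - q)) d"
      using Q X qn by auto
    then obtain Y1 Y2 where Y: "Y1 \<in> carrier_mat q d" "Y2 \<in> carrier_mat (n - q) d"
      "mat_adjoint Q * X = Y1 @\<^sub>r Y2"
      by (rule append_rows_split)
    have "Q * (mat_adjoint Q * X) = X"
      using mat_assoc_dim[of Q "mat_adjoint Q" X] Q(1) X(1) unfolding QQ(1) by (simp add: mat_one_mult_dim)
    then have XY: "X = Q * (Y1 @\<^sub>r Y2)"
      unfolding Y(3) by simp
    then have "mat_adjoint R * Y1 = L"
      using X(2) KQY[OF Y(1,2)] by simp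
    then have "T = inv_mat (mat_adjoint R) * mat_adjoint R * Y1"
      unfolding T_def using inv(1) R Y(1) by (auto simp: mat_assoc_dim)
    then have "T = Y1"
      unfolding inv(3) using Y(1) by (simp add: mat_one_mult_dim)
    then show "\<exists>Y \<in> carrier_mat (n - q) d. X = Q * (T @\<^sub>r Y)"
      using XY Y(2) by blast
  next
    assume "\<exists>Y \<in> carrier_mat (n - q) d. X = Q * (T @\<^sub>r Y)"
    then obtain Y where Y: "Y \<in> carrier_mat (n - q) d" and X: "X = Q * (T @\<^sub>r Y)"
      by blast
    have "K * X = mat_adjoint R * T"
      unfolding X by (rule KQY[OF T Y])
    also have "\<dots> = mat_adjoint R * inv_mat (mat_adjoint R) * L"
      unfolding T_def using inv(1) R L by (simp add: mat_assoc_dim)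
    finally have "K * X = L"
      unfolding inv(2) using L by (simp add: mat_one_mult_dim)
    moreover have "X \<in> carrier_mat n d"
      unfolding X using Q(1) carrier_append_rows[OF T Y] qn by auto
    ultimately show "X \<in> carrier_mat n d \<and> K * X = L"
      by blast
  qed
qed

text \<open>The constrained problem becomes an unconstrained least squares problem for
  \<open>P2\<close> and \<open>W\<close> through the parametrization \<open>\<Phi>\<close> of the
  feasible set. The equivalence yields existence and uniqueness of the minimum norm solution
  together with its formula.\<close>

lemma lse_min_norm_iff:
  fixes E F K L Q R P1 P2 :: "complex mat"
  assumes E: "E \<in> carrier_mat l n" and F: "F \<in> carrier_mat l d" and L: "L \<in> carrier_mat q d"
    and Q: "Q \<in> carrier_mat n n" "unitary_mat Q" and R: "R \<in> carrier_mat q q" "invertible_mat R"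
    and qn: "q \<le> n"
    and K: "mat_adjoint K = Q * (R @\<^sub>r 0\<^sub>m (n - q) q)"
    and P1: "P1 \<in> carrier_mat l q" and P2: "P2 \<in> carrier_mat l (n - q)"
    and EQ: "E * Q = P1 @\<^sub>c P2"
  defines "T \<equiv> inv_mat (mat_adjoint R) * L"
  shows "is_arg_min frob_norm (lse_solution n d E F K L) X \<longleftrightarrow>
    X = Q * (T @\<^sub>r (pinv P2 * (F - P1 * T)))"
proof -
  define W where "W = F - P1 * T"
  define \<Phi> where "\<Phi> Y = Q * (T @\<^sub>r Y)" for Y
  define Ys where "Ys = (carrier_mat (n - q) d :: complex mat set)"
  define Y0 where "Y0 = pinv P2 * W"
  have T: "T \<in> carrier_mat q d"
    using mat_inverse_adjoint(1)[OF R] L by (auto simp: T_def)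
  have W: "W \<in> carrier_mat l d"
    using F P1 T by (auto simp: W_def)
  have Y0: "Y0 \<in> Ys"
    using pinv_carrier[OF P2] W by (auto simp: Y0_def Ys_def)
  have TY: "T @\<^sub>r Y \<in> carrier_mat n d" if "Y \<in> Ys" for Y
    using carrier_append_rows[OF T that[unfolded Ys_def]] qn by simp
  have obj: "frob_norm (E * \<Phi> Y - F) = frob_norm (P2 * Y - W)" if Y: "Y \<in> Ys" for Y
  proof -
    have "E * \<Phi> Y = (P1 @\<^sub>c P2) * (T @\<^sub>r Y)"
      unfolding \<Phi>_def EQ[symmetric] using E Q(1) TY[OF Y] by (auto simp: mat_assoc_dim)
    also have "\<dots> = P1 * T + P2 * Y"
      using append_cols_mult_append_rows[OF P1 P2 T] Y by (simp add: Ys_def)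
    finally have "E * \<Phi> Y - F = P2 * Y - W"
      unfolding W_def using P1 P2 T F Y by (intro eq_matI) (auto simp: Ys_def)
    then show ?thesis
      by simp
  qed
  have norm: "(frob_norm (\<Phi> Y))\<^sup>2 = (frob_norm T)\<^sup>2 + (frob_norm Y)\<^sup>2" if Y: "Y \<in> Ys" for Y
  proof -
    have "mat_adjoint Q * Q = 1\<^sub>m n"
      using Q by (auto simp: unitary_mat_def inverts_mat_def)
    from frob_norm_unitary_mult[OF Q(1) this TY[OF Y]] show ?thesis
      using frob_norm_append_rows[OF T] Y by (simp add: \<Phi>_def Ys_def)
  qed
  have feas: "Z \<in> carrier_mat n d \<and> K * Z = L \<longleftrightarrow> (\<exists>Y\<in>Ys. Z = \<Phi> Y)" for Z
    unfolding Ys_def \<Phi>_def T_def by (rule lse_feasible_iff[OF Q R L qn K])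
  \<comment> \<open>Optimality over feasible \<open>Z\<close> is pulled back to \<open>Ys\<close>,
    where \<open>obj\<close> replaces the objective and the least squares criterion describes the
    minimizers.\<close>
  have sol: "lse_solution n d E F K L Z \<longleftrightarrow> (\<exists>Y\<in>Ys. Z = \<Phi> Y \<and> P2 * Y = P2 * Y0)" for Z
  proof -
    have "lse_solution n d E F K L Z \<longleftrightarrow>
        (\<exists>Y\<in>Ys. Z = \<Phi> Y \<and> (\<forall>Y'\<in>Ys. frob_norm (E * \<Phi> Y - F) \<le> frob_norm (E * \<Phi> Y' - F)))"
      unfolding lse_solution_def is_arg_min_linorder feas by blast
    also have "\<dots> \<longleftrightarrow>
        (\<exists>Y\<in>Ys. Z = \<Phi> Y \<and> (\<forall>Y'\<in>Ys. frob_norm (P2 * Y - W) \<le> frob_norm (P2 * Y' - W)))"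
      by (simp add: obj cong: bex_cong ball_cong)
    also have "\<dots> \<longleftrightarrow> (\<exists>Y\<in>Ys. Z = \<Phi> Y \<and> P2 * Y = P2 * Y0)"
      using lstsq_arg_min_iff[OF P2 W] unfolding Ys_def Y0_def by blast
    finally show ?thesis .
  qed
  \<comment> \<open>All solutions share the block \<open>T\<close>, so their norms differ only
    through \<open>Y\<close>; the excess over \<open>Y0\<close> is the squared distance to
    \<open>Y0\<close>, which gives minimality and uniqueness at once.\<close>
  have pyth: "(frob_norm (\<Phi> Y))\<^sup>2 = (frob_norm (\<Phi> Y0))\<^sup>2 + (frob_norm (Y - Y0))\<^sup>2"
    if "Y \<in> Ys" "P2 * Y = P2 * Y0" for Y
    using lstsq_solution_norm[OF P2 W, of Y] that norm[OF that(1)] norm[OF Y0]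
    by (simp add: Ys_def Y0_def)
  have "is_arg_min frob_norm (lse_solution n d E F K L) X \<longleftrightarrow> X = \<Phi> Y0"
  proof
    assume min: "is_arg_min frob_norm (lse_solution n d E F K L) X"
    then obtain Y where Y: "Y \<in> Ys" "X = \<Phi> Y" "P2 * Y = P2 * Y0"
      unfolding is_arg_min_linorder sol by blast
    have "frob_norm X \<le> frob_norm (\<Phi> Y0)"
      using min Y0 unfolding is_arg_min_linorder sol by blast
    then have "(frob_norm (\<Phi> Y))\<^sup>2 \<le> (frob_norm (\<Phi> Y0))\<^sup>2"
      unfolding Y(2) by (intro power_mono frob_norm_nonneg)
    then have "frob_norm (Y - Y0) = 0"
      using pyth[OF Y(1,3)] by simp
    then have "Y = Y0"
      using Y(1) Y0 by (simp add: frob_norm_minus_eq_0_iff Ys_def)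
    then show "X = \<Phi> Y0"
      using Y(2) by simp
  next
    assume X: "X = \<Phi> Y0"
    have "frob_norm (\<Phi> Y0) \<le> frob_norm Z" if "lse_solution n d E F K L Z" for Z
    proof -
      from that obtain Y where Y: "Y \<in> Ys" "P2 * Y = P2 * Y0" and Z: "Z = \<Phi> Y"
        by (auto simp: sol)
      have "(frob_norm (\<Phi> Y0))\<^sup>2 \<le> (frob_norm Z)\<^sup>2"
        unfolding Z using pyth[OF Y] by simp
      then show ?thesis
        by (rule power2_le_imp_le[OF _ frob_norm_nonneg])
    qed
    moreover have "lse_solution n d E F K L (\<Phi> Y0)"
      unfolding sol using Y0 by (intro bexI[of _ Y0]) simp_all
    ultimately show "is_arg_min frob_norm (lse_solution n d E F K L) X"
      by (simp add: is_arg_min_linorder X)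
  qed
  then show ?thesis
    unfolding \<Phi>_def Y0_def W_def .
qed

section \<open>Transfer to reduced biquaternion matrices\<close>

theorem theorem4p1:
  fixes A B C D :: "rbq mat"
    and M1 M2 N1 N2 R1 R2 S1 S2 Q R P1 P2 :: "complex mat"
    and m n d p :: nat
  assumes "M1 \<in> carrier_mat m n" "M2 \<in> carrier_mat m n" "A = rbq_mat2 M1 M2"
    and "N1 \<in> carrier_mat m d" "N2 \<in> carrier_mat m d" "B = rbq_mat2 N1 N2"
    and "R1 \<in> carrier_mat p n" "R2 \<in> carrier_mat p n" "C = rbq_mat2 R1 R2"
    and "S1 \<in> carrier_mat p d" "S2 \<in> carrier_mat p d" "D = rbq_mat2 S1 S2"
    and "m \<ge> n + d"
    and "vec_space.rank (2 * p) (block_col C) = 2 * p"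
    and "Q \<in> carrier_mat n n" "unitary_mat Q"
    and "R \<in> carrier_mat (2 * p) (2 * p)" "invertible_mat R" "upper_triangular R"
    and "mat_adjoint (block_col C) = Q * (R @\<^sub>r 0\<^sub>m (n - 2 * p) (2 * p))"
    and "P1 \<in> carrier_mat (2 * m) (2 * p)" "P2 \<in> carrier_mat (2 * m) (n - 2 * p)"
    and "block_col A * Q = P1 @\<^sub>c P2"
  shows "(\<forall>X \<in> carrier_mat n d.
            rblse_solution n d A B C D X \<longleftrightarrow>
            lse_solution n d (block_col A) (block_col B) (block_col C) (block_col D) X) \<and>
         (\<forall>X. is_arg_min frob_norm (rblse_solution n d A B C D) X \<longleftrightarrow>
            X = Q * ((inv_mat (mat_adjoint R) * block_col D) @\<^sub>r
                     (pinv P2 * (block_col B - P1 * (inv_mat (mat_adjoint R) * block_col D)))))"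
proof -
  have A: "A \<in> carrier_mat m n" and B: "B \<in> carrier_mat m d"
    and C: "C \<in> carrier_mat p n" and D: "D \<in> carrier_mat p d"
    using assms by (auto simp: rbq_mat2_def)
  note eq = rblse_solution_eq_lse_solution[OF A B C D]
  \<comment> \<open>Counting columns of the partition gives \<open>n = 2 * p + (n - 2 * p)\<close>;
    with truncated subtraction this forces \<open>2 * p \<le> n\<close>.\<close>
  have "dim_col (block_col A * Q) = 2 * p + (n - 2 * p)"
    unfolding assms(23) using assms(21,22) by (simp add: append_cols_def)
  then have "2 * p \<le> n"
    using \<open>Q \<in> carrier_mat n n\<close> by simp
  from lse_min_norm_iff[OF block_col_carrier[OF A] block_col_carrier[OF B] block_col_carrier[OF D]
      \<open>Q \<in> carrier_mat n n\<close> \<open>unitary_mat Q\<close> \<open>R \<in> carrier_mat (2 * p) (2 * p)\<close> \<open>invertible_mat R\<close>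
      this assms(20-23)]
  show ?thesis
    unfolding eq by blast
qed

end
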